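(* For $N \in \mathbb{N}$ let $Q_N$ be the set of the first $N$ points of the two-dimensional Sobol' sequence. For every $m \in \mathbb{N}$, \[ q_\infty(Q_{2^m}) \le 2^{-3m/4 - 5/4}, \] and for every $m \in \mathbb{N}$ with $m \ne 1, 5$, \[ q_\infty(Q_{2^m}) \le 2^{-3m/4 - 3/2}. \] Moreover, equality holds in the second inequality if $m = 2^v - 2$ for some integer $v \ge 2$.
   Context: $\mathbb{N}$ is the set of positive integers, $\mathbb{N}_0 = \mathbb{N} \cup \{0\}$, and $\mathbb{F}_2$ is the field with two elements. For a finite set $Q \subset [0,1]^2$ with at least two points, the $\ell^\infty$-separation radius is $q_\infty(Q) := \frac12 \min_{x,y \in Q,\, x \ne y} \|x-y\|_\infty$. For $m \in \mathbb{N}$ and an integer $0 \le n < 2^m$ with binary expansion $n = n_1 + 2n_2 + \cdots + 2^{m-1} n_m$, $n_i \in \{0,1\}$, put $\vec{n} = (n_1,\dots,n_m)^\top \in \mathbb{F}_2^m$. For $\vec{z} = (z_1,\dots,z_m)^\top \in \mathbb{F}_2^m$, identify each $z_i$ with an element of $\{0,1\}$ and put $\phi(\vec{z}) = \sum_{i=1}^m z_i 2^{-i} \in [0,1)$. The Pascal matrix $P_m \in \mathbb{F}_2^{m\times m}$ has $(i,j)$ entry $\binom{j-1}{i-1} \bmod 2$ for $1 \le i,j \le m$. The two-dimensional Sobol' sequence $(\boldsymbol{x}_n)_{n \in \mathbb{N}_0}$ in $[0,1)^2$ is defined by $\boldsymbol{x}_n := (\phi(\vec{n}), \phi(P_m \vec{n}))$,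 where $m \in \mathbb{N}$ is any integer with $n < 2^m$ (the value does not depend on the choice of $m$), the product $P_m\vec n$ being taken over $\mathbb{F}_2$. The set of the first $N$ points is $Q_N = \{\boldsymbol{x}_0, \dots, \boldsymbol{x}_{N-1}\}$. *)

theory Defs
  imports "HOL-Analysis.Analysis" "HOL-Library.Z2" "Jordan_Normal_Form.Matrix"
begin

unbundle no vec_syntax

text \<open>
  The field with two elements is the type \<^typ>\<open>bit\<close>. Vectors and matrices over it are those of
  \<^theory>\<open>Jordan_Normal_Form.Matrix\<close>, whose indices start at 0; all indices are therefore shifted
  down by one against the usual 1-based convention for digital sequences.
\<close>

text \<open>\<^term>\<open>of_nat\<close> into \<^typ>\<open>bit\<close> is reduction modulo 2, so the entries are the binary digits
  of \<open>n\<close>, least significant first.\<close>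

definition digits :: "nat \<Rightarrow> nat \<Rightarrow> bit vec" where
  "digits m n = vec m (\<lambda>i. of_nat (n div 2 ^ i))"

definition radical_inverse :: "bit vec \<Rightarrow> real" where
  "radical_inverse z = (\<Sum>i<dim_vec z. of_bool (z $ i = 1) / 2 ^ (i + 1))"

definition pascal :: "nat \<Rightarrow> bit mat" where
  "pascal m = mat m m (\<lambda>(i, j). of_nat (j choose i))"

definition sobol_digital :: "nat \<Rightarrow> nat \<Rightarrow> real \<times> real" where
  "sobol_digital m n =
     (radical_inverse (digits m n), radical_inverse (pascal m *\<^sub>v digits m n))"

text \<open>The choice of the number \<open>m\<close> of digits is immaterial, see \<open>sobol_eq\<close> below.\<close>

definition sobol :: "nat \<Rightarrow> real \<times> real" where
  "sobol n = sobol_digital (SOME m. 0 < m \<and> n < 2 ^ m) n"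

definition sobol_set :: "nat \<Rightarrow> (real \<times> real) set" where
  "sobol_set N = sobol ` {..<N}"

text \<open>On \<open>\<real>\<^sup>2\<close>, \<^const>\<open>infnorm\<close> is the maximum norm, whereas \<^const>\<open>norm\<close> is the Euclidean one.
  The minimum is meaningful for finite sets with at least two points only.\<close>

definition separation_radius :: "(real \<times> real) set \<Rightarrow> real" where
  "separation_radius Q = Min {infnorm (x - y) | x y. x \<in> Q \<and> y \<in> Q \<and> x \<noteq> y} / 2"

lemma digits_eq_0: "n < 2 ^ m \<Longrightarrow> m \<le> i \<Longrightarrow> n div 2 ^ i = 0"
  for n :: nat
  by (meson div_less less_le_trans one_le_numeral power_increasing)

lemma radical_inverse_digits_mono:
  assumes "n < 2 ^ m" "m \<le> M"
  shows "radical_inverse (digits M n) = radical_inverse (digits m n)"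
proof -
  have "(\<Sum>i<M. of_bool (of_nat (n div 2 ^ i) = (1 :: bit)) / 2 ^ (i + 1)) =
        (\<Sum>i<m. of_bool (of_nat (n div 2 ^ i) = (1 :: bit)) / (2 :: real) ^ (i + 1))"
    using assms by (intro sum.mono_neutral_right) (auto simp: digits_eq_0[OF assms(1)])
  then show ?thesis
    by (simp add: radical_inverse_def digits_def)
qed

lemma pascal_digits_nth:
  assumes "n < 2 ^ m" "m \<le> M" "i < M"
  shows "(pascal M *\<^sub>v digits M n) $ i = (\<Sum>j<m. of_nat (j choose i) * of_nat (n div 2 ^ j))"
proof -
  have "(pascal M *\<^sub>v digits M n) $ i = (\<Sum>j<M. of_nat (j choose i) * of_nat (n div 2 ^ j))"
    using assms(3) by (simp add: pascal_def digits_def scalar_prod_def atLeast0LessThan)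
  also have "\<dots> = (\<Sum>j<m. of_nat (j choose i) * of_nat (n div 2 ^ j))"
    using assms by (intro sum.mono_neutral_right) (auto simp: digits_eq_0[OF assms(1)])
  finally show ?thesis .
qed

lemma radical_inverse_pascal_digits_mono:
  assumes "n < 2 ^ m" "m \<le> M"
  shows "radical_inverse (pascal M *\<^sub>v digits M n) = radical_inverse (pascal m *\<^sub>v digits m n)"
proof -
  let ?c = "\<lambda>i. (\<Sum>j<m. of_nat (j choose i) * of_nat (n div 2 ^ j)) :: bit"
  have eq: "radical_inverse (pascal k *\<^sub>v digits k n) = (\<Sum>i<k. of_bool (?c i = 1) / 2 ^ (i + 1))"
    if "m \<le> k" for k
  proof -
    have "dim_vec (pascal k *\<^sub>v digits k n) = k"
      by (simp add: pascal_def)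
    then show ?thesis
      unfolding radical_inverse_def
      by (intro sum.cong) (simp_all only: pascal_digits_nth[OF assms(1) that] lessThan_iff)
  qed
  have "?c i = 0" if "m \<le> i" for i
    using that by (intro sum.neutral) (auto simp: binomial_eq_0)
  then have "(\<Sum>i<M. of_bool (?c i = 1) / 2 ^ (i + 1)) =
             (\<Sum>i<m. of_bool (?c i = 1) / (2 :: real) ^ (i + 1))"
    using assms(2) by (intro sum.mono_neutral_right) auto
  then show ?thesis
    by (simp only: eq[OF assms(2)] eq[OF order_refl])
qed

lemma sobol_eq:
  assumes "n < 2 ^ m"
  shows "sobol n = sobol_digital m n"
proof -
  define k where "k = (SOME m. 0 < m \<and> n < 2 ^ m)"
  have "0 < Suc n \<and> n < 2 ^ Suc n"
    using less_exp[of "Suc n"] by linarith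
  then have k: "n < 2 ^ k"
    unfolding k_def by (metis (mono_tags, lifting) someI_ex)
  have *: "sobol_digital b n = sobol_digital a n" if "n < 2 ^ a" "a \<le> b" for a b
    unfolding sobol_digital_def
    by (simp only: radical_inverse_digits_mono[OF that] radical_inverse_pascal_digits_mono[OF that])
  have "sobol_digital k n = sobol_digital m n"
    using *[OF k, of m] *[OF assms, of k] by (metis nle_le)
  then show ?thesis
    by (simp add: sobol_def k_def)
qed

end

theory Submission
  imports Defs
begin

text \<open>
  Read the binary digits of \<open>n\<close> as the coefficients of a polynomial \<open>p\<close> over the field with two
  elements. The Pascal matrix is the substitution \<open>X \<mapsto> X + 1\<close>, so the two coordinates of a point are
  the values of the digit strings of \<open>p(X)\<close> and \<open>p(X + 1)\<close>.

  Close points arise from \<open>X\<^sup>L (1 + X)\<^bsup>K - 1\<^esup>\<close> and \<open>X\<^bsup>L - 1\<^esup> (1 + X)\<^sup>K\<close> with powers of two \<open>L\<close>, \<open>K\<close>: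
  since \<open>(1 + X)\<^sup>K = 1 + X\<^sup>K\<close> and \<open>(1 + X)\<^bsup>K - 1\<^esup> = 1 + \<dots> + X\<^bsup>K - 1\<^esup>\<close>, the digit strings around
  position \<open>L\<close> are \<open>01\<dots>1\<close> and \<open>10\<dots>01\<close>, and the substitution exchanges the two shapes. This gives
  the radius \<open>2\<^bsup>-(L + K)\<^esup>\<close> whenever \<open>L + K \<le> m\<close>, which suffices for \<open>m \<noteq> 5\<close> unless \<open>m\<close> or \<open>m + 1\<close> is a
  power of two; then there are points at distance \<open>2\<^bsup>-m\<^esup>\<close>.

  Conversely, let \<open>m = 4 w - 2\<close> with \<open>w\<close> a power of two. If both coordinates of two points differ by
  less than \<open>2\<^bsup>-(3 w - 1)\<^esup>\<close>, then in both coordinates the first \<open>3 w - 1\<close> digits are equal or differ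
  by a carry, so the sum \<open>e\<close> of the two polynomials satisfies
  \<open>(1 + X) e \<equiv> X\<^sup>a (mod X\<^bsup>3 w - 1\<^esup>)\<close> and \<open>X e \<equiv> (1 + X)\<^sup>b (mod (1 + X)\<^bsup>3 w - 1\<^esup>)\<close>.
  Eliminating \<open>e\<close> and comparing coefficients in blocks of length \<open>w\<close> shows \<open>deg e < 3 w - 1\<close>. Hence
  the last digits agree, the first coordinates differ by a multiple of \<open>2\<^bsup>-(3 w - 1)\<^esup>\<close>, and the
  points coincide.
\<close>

section \<open>Polynomials over the field with two elements\<close>

lemma bit_poly_add_self [simp]: "p + p = (0 :: bit poly)"
proof (rule poly_eqI)
  show "coeff (p + p) n = coeff 0 n" for n
    by (cases "coeff p n") (simp_all only: coeff_add coeff_0, simp_all)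
qed

lemma bit_poly_power_2_add: "(p + q) ^ 2 ^ n = p ^ 2 ^ n + q ^ 2 ^ n" for p q :: "bit poly"
proof (induction n)
  case (Suc n)
  have "(p + q) ^ 2 ^ Suc n = (p ^ 2 ^ n + q ^ 2 ^ n)\<^sup>2"
    by (simp only: Suc.IH power_Suc2 power_mult)
  also have "\<dots> = (p ^ 2 ^ n)\<^sup>2 + (q ^ 2 ^ n)\<^sup>2 + (p ^ 2 ^ n * q ^ 2 ^ n + p ^ 2 ^ n * q ^ 2 ^ n)"
    by (simp only: power2_eq_square ring_distribs ac_simps)
  also have "\<dots> = p ^ 2 ^ Suc n + q ^ 2 ^ Suc n"
    by (simp only: bit_poly_add_self power_Suc2 power_mult add_0_right)
  finally show ?case .
qed simp

lemma one_plus_X_power_2: "[:1, 1 :: bit:] ^ 2 ^ n = 1 + monom 1 (2 ^ n)"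
proof -
  have "[:1, 1 :: bit:] = 1 + monom 1 1"
    by (simp add: monom_altdef one_pCons)
  then show ?thesis
    by (simp add: bit_poly_power_2_add monom_power)
qed

definition unit_sum :: "nat \<Rightarrow> bit poly" where
  "unit_sum n = (\<Sum>i<n. monom 1 i)"

lemma coeff_unit_sum: "coeff (unit_sum n) i = of_bool (i < n)"
  by (simp add: unit_sum_def coeff_sum)

lemma coeff_one_plus_X_mult:
  "coeff ([:1, 1:] * p) i = coeff p i + (if i = 0 then 0 else coeff p (i - 1))" for p :: "bit poly"
  by (cases i) simp_all

lemma one_plus_X_mult_unit_sum: "[:1, 1:] * unit_sum n = 1 + monom 1 n"
  by (rule poly_eqI) (auto simp: coeff_one_plus_X_mult coeff_unit_sum simp del: mult_pCons_left)

text \<open>Multiplied by \<open>1 + X\<close>, both sides become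
  \<open>1 + X ^ 2 ^ n\<close>.\<close>

lemma one_plus_X_power_eq_unit_sum: "[:1, 1:] ^ (2 ^ n - 1) = unit_sum (2 ^ n)"
proof -
  have "[:1, 1 :: bit:] * [:1, 1:] ^ (2 ^ n - 1) = [:1, 1:] * unit_sum (2 ^ n)"
    by (subst power_Suc[symmetric])
      (simp add: one_plus_X_mult_unit_sum one_plus_X_power_2 del: power_Suc mult_pCons_left)
  then show ?thesis
    by (subst (asm) mult_left_cancel) auto
qed

lemma bit_add_eq_of_bool_iff: "x + y = of_bool P \<longleftrightarrow> (x = y \<longleftrightarrow> \<not> P)" for x y :: bit
  by (cases x; cases y) auto

lemma bit_add_eq_of_bool_add_iff:
  "x + y = of_bool P + z \<longleftrightarrow> (z = 0 \<longleftrightarrow> (x = y \<longleftrightarrow> \<not> P))" for x y z :: bit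
  by (cases x; cases y; cases z) auto

text \<open>The term \<open>(1 + X)\<^bsup>3 w\<^esup> s\<close> repeats the coefficients of \<open>s\<close> in four consecutive blocks of length \<open>w\<close>.
  So \<open>X\<^sup>A + (1 + X)\<^sup>B\<close> is \<open>w\<close>-periodic on the first three blocks, while \<open>X\<^sup>A\<close> touches at most one of them.\<close>

lemma block_equation:
  fixes r s :: "bit poly"
  assumes w: "w = 2 ^ v"
    and A: "0 < A" "A \<le> 3 * w" and B: "B \<le> 3 * w"
    and deg: "degree r < w" "degree s < w"
    and eq: "monom 1 A + monom 1 (3 * w) * r = [:1, 1:] ^ B + [:1, 1:] ^ (3 * w) * s"
  shows "r = 1"
proof -
  let ?X = "[:1, 1 :: bit:]"
  define j where "j = B mod w"
  define c where "c = ?X ^ j"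
  have "0 < w"
    by (simp add: w)
  then have "j < w"
    by (simp add: j_def)
  have pw: "?X ^ w = 1 + monom 1 w"
    by (simp add: w one_plus_X_power_2)
  have pw2: "?X ^ (2 * w) = 1 + monom 1 (2 * w)"
    using one_plus_X_power_2[of "Suc v"] by (simp add: w)
  have pw3: "?X ^ (3 * w) = 1 + monom 1 w + monom 1 (2 * w) + monom 1 (3 * w)"
  proof -
    have "?X ^ (3 * w) = ?X ^ w * ?X ^ (2 * w)"
      by (simp flip: power_add)
    then show ?thesis
      by (simp add: pw pw2 ring_distribs mult_monom flip: mult_2)
  qed
  have deg_c: "degree c < w"
    using \<open>j < w\<close> by (simp add: c_def degree_power_eq)
  have c0: "coeff c 0 = 1"
    by (simp add: c_def coeff_0_power)
  note z = coeff_eq_0[OF less_le_trans[OF deg(1)]] coeff_eq_0[OF less_le_trans[OF deg(2)]]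
    coeff_eq_0[OF less_le_trans[OF deg_c]]
  have rhs: "coeff (?X ^ (3 * w) * s) i = coeff s i"
      "coeff (?X ^ (3 * w) * s) (w + i) = coeff s i"
      "coeff (?X ^ (3 * w) * s) (2 * w + i) = coeff s i"
      "coeff (?X ^ (3 * w) * s) (3 * w + i) = coeff s i" if "i < w" for i
    using that by (simp_all add: pw3 ring_distribs coeff_monom_mult z)
  have lhs: "coeff (monom 1 A + monom 1 (3 * w) * r) i = of_bool (A = i)"
      "coeff (monom 1 A + monom 1 (3 * w) * r) (w + i) = of_bool (A = w + i)"
      "coeff (monom 1 A + monom 1 (3 * w) * r) (2 * w + i) = of_bool (A = 2 * w + i)"
      "coeff (monom 1 A + monom 1 (3 * w) * r) (3 * w + i) = of_bool (A = 3 * w + i) + coeff r i"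
    if "i < w" for i
    using that by (simp_all add: coeff_monom_mult)
  \<comment> \<open>In the first three blocks \<open>(1 + X) ^ B\<close> agrees with
    \<open>s\<close> except where \<open>X ^ A\<close> sits; the fourth block then determines
    \<open>r\<close>.\<close>
  have eqs: "coeff (?X ^ B) i = coeff s i \<longleftrightarrow> A \<noteq> i"
      "coeff (?X ^ B) (w + i) = coeff s i \<longleftrightarrow> A \<noteq> w + i"
      "coeff (?X ^ B) (2 * w + i) = coeff s i \<longleftrightarrow> A \<noteq> 2 * w + i"
      "coeff r i = 0 \<longleftrightarrow> (coeff (?X ^ B) (3 * w + i) = coeff s i \<longleftrightarrow> A \<noteq> 3 * w + i)"
    if "i < w" for i
    using lhs[OF that] unfolding eq coeff_add rhs[OF that]
    by (simp_all only: bit_add_eq_of_bool_iff bit_add_eq_of_bool_add_iff)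
  have "coeff r i = of_bool (i = 0)" if i: "i < w" for i
  proof -
    have "B div w \<le> 3"
      using div_le_mono[OF B, of w] \<open>0 < w\<close> by simp
    then consider "B div w = 0" | "B div w = 1" | "B div w = 2" | "B div w = 3"
      by linarith
    then show ?thesis
    proof cases
      \<comment> \<open>Impossible: \<open>(1 + X) ^ B\<close> lives in block 0, where its constant
        term 1 is that of \<open>s\<close>, so \<open>A\<close> would be both \<open>w\<close> and
        \<open>2 * w\<close>.\<close>
      case 1
      then have "?X ^ B = c"
        using div_mult_mod_eq[of B w] by (simp add: c_def j_def)
      then show ?thesis
        using eqs[OF \<open>0 < w\<close>] \<open>0 < w\<close> A(1)
        by (simp add: c0 z of_bool_def split: if_splits)
    next
      \<comment> \<open>Block 2 of \<open>(1 + X) ^ B\<close> vanishes while \<open>s\<close> has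
        constant term 1, so \<open>A = 2 * w\<close>; the rest of block 2 gives
        \<open>s = 1\<close>. The next case is alike with block 1 and \<open>A = w\<close>.\<close>
      case 2
      then have "B = w + j"
        using div_mult_mod_eq[of B w] by (simp add: j_def)
      then have "?X ^ B = c + monom 1 w * c"
        by (simp add: c_def power_add pw ring_distribs)
      then show ?thesis
        using eqs[OF \<open>0 < w\<close>] eqs[OF i] i \<open>0 < w\<close> A(1)
        by (auto simp add: c0 z of_bool_def coeff_monom_mult split: if_splits)
    next
      case 3
      then have "B = 2 * w + j"
        using div_mult_mod_eq[of B w] by (simp add: j_def)
      then have "?X ^ B = c + monom 1 (2 * w) * c"
        by (simp add: c_def power_add pw2 ring_distribs)
      then show ?thesis
        using eqs[OF \<open>0 < w\<close>] eqs[OF i] i \<open>0 < w\<close> A(1)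
        by (auto simp add: c0 z of_bool_def coeff_monom_mult split: if_splits)
    next
      case 4
      then have "B = 3 * w"
        using div_mult_mod_eq[of B w] B by simp
      \<comment> \<open>All blocks of \<open>(1 + X) ^ B\<close> coincide here, so a single
        exception among the first three is contradictory.\<close>
      have "A = 3 * w"
      proof (rule ccontr)
        assume "A \<noteq> 3 * w"
        with A have "A div w < 3"
          by (simp add: less_mult_imp_div_less)
        then consider "A div w = 0" | "A div w = 1" | "A div w = 2"
          by linarith
        then have "A = u \<or> A = w + u \<or> A = 2 * w + u" if "u = A mod w" for u
          using div_mult_mod_eq[of A w] by cases (simp_all flip: that)
        then obtain u where u: "u < w" "A = u \<or> A = w + u \<or> A = 2 * w + u"
          using mod_less_divisor[OF \<open>0 < w\<close>] by blast
        have "coeff (?X ^ B) u = of_bool (u = 0)" "coeff (?X ^ B) (w + u) = of_bool (u = 0)"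
            "coeff (?X ^ B) (2 * w + u) = of_bool (u = 0)"
          using u(1) \<open>B = 3 * w\<close> by (simp_all add: pw3)
        then show False
          using eqs[OF u(1)] u \<open>0 < w\<close> by auto
      qed
      then show ?thesis
        using eqs[OF \<open>0 < w\<close>] eqs[OF i] i \<open>0 < w\<close> \<open>B = 3 * w\<close>
        by (auto simp add: pw3 of_bool_def split: if_splits)
    qed
  qed
  moreover have "coeff r i = of_bool (i = 0)" if "w \<le> i" for i
    using that \<open>0 < w\<close> by (simp add: z)
  ultimately have "coeff r i = coeff 1 i" for i
    by (cases "i < w") simp_all
  then show ?thesis
    by (rule poly_eqI)
qed

section \<open>Points of the sequence as polynomials\<close>

text \<open>The constant term is the most significant digit, so nearby values constrain the
  coefficients of low degree.\<close>

definition binary_value :: "nat \<Rightarrow> bit poly \<Rightarrow> real" where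
  "binary_value m p = (\<Sum>i<m. of_bool (coeff p i = 1) / 2 ^ (i + 1))"

definition sobol_point :: "nat \<Rightarrow> bit poly \<Rightarrow> real \<times> real" where
  "sobol_point m p = (binary_value m p, binary_value m (p \<circ>\<^sub>p [:1, 1:]))"

lemma pcompose_monom: "monom c n \<circ>\<^sub>p q = Polynomial.smult c (q ^ n)" for q :: "'a :: comm_semiring_1 poly"
  by (induction n) (simp_all add: monom_0 monom_Suc pcompose_pCons)

text \<open>Binomial theorem on each monomial; over \<open>bit\<close> the weights are the entries
  of \<open>pascal\<close>.\<close>

lemma coeff_pcompose_one_plus_X:
  fixes p :: "'a :: comm_semiring_1 poly"
  assumes "degree p < m"
  shows "coeff (p \<circ>\<^sub>p [:1, 1:]) i = (\<Sum>j<m. of_nat (j choose i) * coeff p j)"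
proof -
  have "p = (\<Sum>j<m. monom (coeff p j) j)"
    using poly_as_sum_of_monoms'[of p "m - 1"] assms by (cases m) (simp_all add: lessThan_Suc_atMost)
  then have "p \<circ>\<^sub>p [:1, 1:] = (\<Sum>j<m. Polynomial.smult (coeff p j) ([:1, 1:] ^ j))"
    by (metis (no_types, lifting) pcompose_monom pcompose_sum sum.cong)
  moreover have "coeff ([:1, 1 :: 'a:] ^ j) i = of_nat (j choose i)" for j
  proof (cases "i \<le> j")
    case False
    then have "degree ([:1, 1 :: 'a:] ^ j) < i"
      using degree_power_le[of "[:1, 1 :: 'a:]" j] by simp
    with False show ?thesis
      by (simp add: coeff_eq_0 binomial_eq_0)
  qed (simp add: coeff_linear_poly_power)
  ultimately show ?thesis
    by (simp add: coeff_sum mult.commute)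
qed

lemma sobol_digital_eq_sobol_point:
  assumes n: "n < 2 ^ m" and p: "degree p < m" "\<And>j. j < m \<Longrightarrow> coeff p j = of_nat (n div 2 ^ j)"
  shows "sobol_digital m n = sobol_point m p"
proof -
  have "radical_inverse (digits m n) = binary_value m p"
    by (simp add: radical_inverse_def digits_def binary_value_def p(2))
  moreover have "(pascal m *\<^sub>v digits m n) $ i = coeff (p \<circ>\<^sub>p [:1, 1:]) i" if "i < m" for i
    using pascal_digits_nth[OF n order_refl that]
    by (simp add: coeff_pcompose_one_plus_X[OF p(1)] p(2))
  then have "radical_inverse (pascal m *\<^sub>v digits m n) = binary_value m (p \<circ>\<^sub>p [:1, 1:])"
    by (simp add: radical_inverse_def binary_value_def pascal_def)
  ultimately show ?thesis
    by (simp add: sobol_digital_def sobol_point_def)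
qed

lemma of_nat_bit_eq: "(of_nat k :: bit) = of_bool (odd k)"
  by (cases "even k") (auto elim!: evenE oddE)

lemma sobol_set_eq:
  assumes "0 < m"
  shows "sobol_set (2 ^ m) = sobol_point m ` {p. degree p < m}"
proof (intro equalityI subsetI)
  fix x assume "x \<in> sobol_set (2 ^ m)"
  then obtain n where n: "n < 2 ^ m" "x = sobol_digital m n"
    by (auto simp: sobol_set_def sobol_eq)
  define p :: "bit poly" where "p = (\<Sum>j<m. monom (of_nat (n div 2 ^ j)) j)"
  have c: "coeff p j = (if j < m then of_nat (n div 2 ^ j) else 0)" for j
    by (simp add: p_def coeff_sum)
  have "degree p < m"
    using assms by (intro degree_lessI) (auto simp: c)
  with n c show "x \<in> sobol_point m ` {p. degree p < m}"
    using sobol_digital_eq_sobol_point[OF n(1), of p] by auto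
next
  fix x assume "x \<in> sobol_point m ` {p. degree p < m}"
  then obtain p where p: "degree p < m" "x = sobol_point m p"
    by auto
  define n :: nat where "n = horner_sum of_bool 2 (map (\<lambda>j. coeff p j = 1) [0..<m])"
  have n: "n < 2 ^ m"
    using horner_sum_of_bool_2_less[of "map (\<lambda>j. coeff p j = 1) [0..<m]"]
    by (simp add: n_def)
  have "coeff p j = of_nat (n div 2 ^ j)" if "j < m" for j
  proof -
    have "odd (n div 2 ^ j) \<longleftrightarrow> coeff p j = 1"
      using that by (simp add: n_def bit_horner_sum_bit_iff flip: bit_iff_odd)
    then show ?thesis
      by (simp only: of_nat_bit_eq) simp
  qed
  then have "x = sobol n"
    using sobol_digital_eq_sobol_point[OF n p(1)] p(2) sobol_eq[OF n] by simp
  with n show "x \<in> sobol_set (2 ^ m)"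
    by (auto simp: sobol_set_def)
qed

section \<open>Values of digit strings and distances of points\<close>

lemma binary_value_add:
  assumes "\<And>i. coeff p i = 0 \<or> coeff q i = 0"
  shows "binary_value m (p + q) = binary_value m p + binary_value m q"
proof -
  have "(of_bool (coeff (p + q) i = 1) :: real) = of_bool (coeff p i = 1) + of_bool (coeff q i = 1)" for i
    using assms[of i] by auto
  then show ?thesis
    unfolding binary_value_def by (simp only: add_divide_distrib sum.distrib)
qed

lemma binary_value_monom: "n < m \<Longrightarrow> binary_value m (monom 1 n) = 1 / 2 ^ (n + 1)"
proof -
  assume "n < m"
  then have "binary_value m (monom 1 n) = (\<Sum>i\<in>{n}. 1 / 2 ^ (i + 1))"
    unfolding binary_value_def by (intro sum.mono_neutral_cong_right) auto
  then show ?thesis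
    by simp
qed

lemma binary_value_monom_mult_unit_sum:
  assumes "n + k \<le> m"
  shows "binary_value m (monom 1 n * unit_sum k) = 1 / 2 ^ n - 1 / 2 ^ (n + k)"
proof -
  have "binary_value m (monom 1 n * unit_sum k) = (\<Sum>i\<in>{n..<n + k}. 1 / 2 ^ (i + 1))"
    unfolding binary_value_def using assms
    by (intro sum.mono_neutral_cong_right) (auto simp: coeff_monom_mult coeff_unit_sum)
  also have "\<dots> = 1 / 2 ^ n - 1 / 2 ^ (n + k)"
  proof (induction k)
    case (Suc k)
    have "1 / 2 ^ (n + k + 1) = (1 / 2 ^ (n + k) - 1 / 2 ^ (n + Suc k) :: real)"
      by (simp add: field_simps)
    with Suc.IH show ?case
      by simp
  qed simp
  finally show ?thesis .
qed

lemma infnorm_Pair: "infnorm (x, y) = max \<bar>x\<bar> \<bar>y\<bar>" for x y :: real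
  by (simp add: infnorm_Max Basis_prod_def)

lemma finite_distances:
  assumes "finite Q"
  shows "finite {infnorm (x - y) | x y. x \<in> Q \<and> y \<in> Q \<and> x \<noteq> y}"
proof (rule finite_subset)
  show "finite ((\<lambda>(x, y). infnorm (x - y)) ` (Q \<times> Q))"
    using assms by simp
qed auto

text \<open>Every close pair constructed below differs by the same \<open>d\<close> in both
  coordinates; \<open>0 < d\<close> makes the points distinct.\<close>

lemma separation_radius_le:
  assumes "0 < m" "degree p < m" "degree q < m"
    and "sobol_point m p - sobol_point m q = (x, y)" and "\<bar>x\<bar> = d" "\<bar>y\<bar> = d" "0 < d"
  shows "separation_radius (sobol_set (2 ^ m)) \<le> d / 2"
proof -
  let ?Q = "sobol_set (2 ^ m)"
  have "finite ?Q"
    by (simp add: sobol_set_def)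
  moreover have "sobol_point m p \<in> ?Q" "sobol_point m q \<in> ?Q"
    using assms by (auto simp: sobol_set_eq)
  moreover have "sobol_point m p \<noteq> sobol_point m q"
    using assms by (auto simp: zero_prod_def)
  moreover have "infnorm (sobol_point m p - sobol_point m q) = d"
    using assms by (simp add: infnorm_Pair)
  ultimately have "Min {infnorm (x - y) | x y. x \<in> ?Q \<and> y \<in> ?Q \<and> x \<noteq> y} \<le> d"
    by (intro Min_le finite_distances) blast+
  then show ?thesis
    by (simp add: separation_radius_def)
qed

section \<open>Close points\<close>

lemma one_plus_X_pcompose [simp]: "[:1, 1 :: bit:] \<circ>\<^sub>p [:1, 1:] = monom 1 1"
  by (simp add: pcompose_pCons monom_altdef)

lemma pcompose_power: "(p ^ n) \<circ>\<^sub>p q = (p \<circ>\<^sub>p q) ^ n" for p q :: "'a :: comm_semiring_1 poly"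
  by (induction n) (simp_all add: pcompose_1 pcompose_mult)

text \<open>In characteristic 2 the substitution swaps \<open>X\<close> and \<open>1 + X\<close>, so
  the exponents trade places.\<close>

lemma monom_mult_one_plus_X_power_pcompose:
  "(monom 1 a * [:1, 1:] ^ b) \<circ>\<^sub>p [:1, 1 :: bit:] = monom 1 b * [:1, 1:] ^ a"
  by (simp add: pcompose_mult pcompose_power pcompose_monom monom_power del: mult_pCons_left mult_pCons_right)

lemma degree_monom_mult_one_plus_X_power: "degree (monom 1 a * [:1, 1 :: bit:] ^ b) = a + b"
  by (simp add: degree_mult_eq degree_power_eq degree_monom_eq)

lemma separation_radius_le_two_powers:
  assumes "2 ^ l + 2 ^ k \<le> m"
  shows "separation_radius (sobol_set (2 ^ m)) \<le> 1 / 2 ^ (2 ^ l + 2 ^ k)"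
proof -
  \<comment> \<open>The value of \<open>p l k\<close> lies below and that of \<open>q l k\<close>
    above \<open>1 / 2 ^ (2 ^ l)\<close>, each by \<open>1 / 2 ^ (2 ^ l + 2 ^ k)\<close>.
    Substitution turns them into \<open>q k l\<close> and \<open>p k l\<close>, so the same happens
    around \<open>1 / 2 ^ (2 ^ k)\<close>.\<close>
  define p where "p i j = monom 1 (2 ^ i) * [:1, 1 :: bit:] ^ (2 ^ j - 1)" for i j :: nat
  define q where "q i j = monom 1 (2 ^ i - 1) * [:1, 1 :: bit:] ^ (2 ^ j)" for i j :: nat
  have p: "binary_value m (p i j) = 1 / 2 ^ (2 ^ i) - 1 / 2 ^ (2 ^ i + 2 ^ j)"
    if "2 ^ i + 2 ^ j \<le> m" for i j
    using that unfolding p_def one_plus_X_power_eq_unit_sum by (rule binary_value_monom_mult_unit_sum)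
  have q: "binary_value m (q i j) = 1 / 2 ^ (2 ^ i) + 1 / 2 ^ (2 ^ i + 2 ^ j)"
    if "2 ^ i + 2 ^ j \<le> m" for i j
  proof -
    have "0 < (2 :: nat) ^ i"
      by simp
    then obtain c :: nat where c: "2 ^ i = Suc c"
      by (metis gr0_conv_Suc)
    have "q i j = monom 1 c + monom 1 (c + 2 ^ j)"
      by (simp add: q_def one_plus_X_power_2 ring_distribs mult_monom c)
    moreover have "binary_value m (monom 1 c + monom 1 (c + 2 ^ j)) = 
        binary_value m (monom 1 c) + binary_value m (monom 1 (c + 2 ^ j))"
      by (rule binary_value_add) auto
    moreover have "c + 2 ^ j < m"
      using that by (simp add: c)
    ultimately show ?thesis
      by (simp add: binary_value_monom c)
  qed
  have "p l k \<circ>\<^sub>p [:1, 1:] = q k l" "q l k \<circ>\<^sub>p [:1, 1:] = p k l"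
    by (simp_all only: p_def q_def monom_mult_one_plus_X_power_pcompose)
  then have diff: "sobol_point m (p l k) - sobol_point m (q l k) =
      (- (2 / 2 ^ (2 ^ l + 2 ^ k)), 2 / 2 ^ (2 ^ l + 2 ^ k))"
    using assms by (simp add: sobol_point_def p q add.commute)
  have pos: "0 < (2 :: nat) ^ l" "0 < (2 :: nat) ^ k"
    by simp_all
  have "degree (p l k) < m" "degree (q l k) < m"
    unfolding p_def q_def degree_monom_mult_one_plus_X_power using assms pos by linarith+
  then show ?thesis
    using separation_radius_le[OF _ _ _ diff refl] pos assms by simp
qed

text \<open>For \<open>m = 2 c + 1\<close>, the digit strings 0^(c+1) 1^c and 0^c 1 0^c have
  adjacent values. Their sum \<open>X ^ c (1 + X) ^ c\<close> is invariant under the substitution,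
  and their images 1^c 0 1^c and 1^(c+1) 0^c are adjacent again.\<close>

lemma separation_radius_le_power_minus_1:
  assumes "m + 1 = 2 ^ s" "0 < m"
  shows "separation_radius (sobol_set (2 ^ m)) \<le> 1 / 2 ^ (m + 1)"
proof -
  obtain t where t: "s = Suc t"
    using assms by (cases s) auto
  have "0 < (2 :: nat) ^ t"
    by simp
  then obtain c where c: "2 ^ t = Suc c"
    by (metis gr0_conv_Suc)
  then have m: "m = Suc (2 * c)"
    using assms(1) t by simp
  then have m': "Suc c + c = m"
    by simp
  define p where "p = monom 1 (Suc c) * unit_sum c"
  define q where "q = monom (1 :: bit) c"
  have unit_sum: "unit_sum (Suc c) = [:1, 1:] ^ c"
    using one_plus_X_power_eq_unit_sum[of t] by (simp add: c)
  have pq: "p + q = monom 1 c * [:1, 1:] ^ c"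
    unfolding unit_sum[symmetric] p_def q_def
    by (rule poly_eqI) (auto simp: coeff_monom_mult coeff_unit_sum)
  have q': "q \<circ>\<^sub>p [:1, 1:] = unit_sum (Suc c)"
    by (simp add: q_def pcompose_monom unit_sum)
  have "p \<circ>\<^sub>p [:1, 1:] = (p + q) \<circ>\<^sub>p [:1, 1:] + q \<circ>\<^sub>p [:1, 1:]"
    by (simp add: pcompose_add add.assoc)
  also have "\<dots> = monom 1 c * unit_sum (Suc c) + unit_sum (Suc c)"
    by (simp only: pq monom_mult_one_plus_X_power_pcompose q' unit_sum)
  also have "\<dots> = unit_sum c + monom 1 (Suc c) * unit_sum c"
    by (rule poly_eqI) (auto simp: coeff_monom_mult coeff_unit_sum)
  finally have "binary_value m (p \<circ>\<^sub>p [:1, 1:]) = binary_value m (unit_sum c) + binary_value m p"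
    unfolding p_def by (auto simp: coeff_monom_mult coeff_unit_sum intro!: binary_value_add)
  moreover have "binary_value m (unit_sum k) = 1 - 1 / 2 ^ k" if "k \<le> m" for k
    using binary_value_monom_mult_unit_sum[of 0 k m] that by (simp add: monom_0)
  moreover have "binary_value m p = 1 / 2 ^ Suc c - 1 / 2 ^ m"
    using binary_value_monom_mult_unit_sum[of "Suc c" c m] m'
    by (simp only: p_def order_refl)
  moreover have "binary_value m q = 1 / 2 ^ Suc c"
    by (simp add: q_def m binary_value_monom)
  ultimately have diff: "sobol_point m p - sobol_point m q = (- (1 / 2 ^ m), - (1 / 2 ^ m))"
    by (simp add: sobol_point_def q' m)
  have "degree q < m" "degree p < m"
    by (auto simp: q_def p_def m degree_monom_eq coeff_monom_mult coeff_unit_sum intro!: degree_lessI)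
  then show ?thesis
    using separation_radius_le[OF _ _ _ diff refl] assms(2) by simp
qed

text \<open>The strings 01...1 and 10...0 have adjacent values. Their sum
  \<open>(1 + X) ^ (m - 1)\<close> becomes \<open>X ^ (m - 1)\<close>, so for \<open>m > 1\<close>
  the images 10...01 and 10...0 are adjacent too.\<close>

lemma separation_radius_le_power:
  assumes "m = 2 ^ s"
  shows "separation_radius (sobol_set (2 ^ m)) \<le> 1 / 2 ^ (m + 1)"
proof -
  have "0 < m"
    by (simp add: assms)
  then obtain c where c: "m = Suc c"
    by (metis gr0_conv_Suc)
  define p where "p = monom 1 1 * unit_sum c"
  have unit_sum: "unit_sum m = [:1, 1:] ^ c"
    using one_plus_X_power_eq_unit_sum[of s] c by (simp flip: assms)
  have p1: "p + 1 = monom 1 0 * [:1, 1:] ^ c"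
    unfolding unit_sum[symmetric] p_def c
    by (rule poly_eqI) (auto simp: coeff_monom_mult coeff_unit_sum)
  have "p \<circ>\<^sub>p [:1, 1:] = (p + 1) \<circ>\<^sub>p [:1, 1:] + 1"
    by (simp add: pcompose_add pcompose_1 add.assoc)
  also have "\<dots> = monom 1 c + monom 1 0"
    by (simp only: p1 monom_mult_one_plus_X_power_pcompose) simp
  finally have p': "p \<circ>\<^sub>p [:1, 1:] = monom 1 c + monom 1 0" .
  have "binary_value m p = 1 / 2 - 1 / 2 ^ m"
    using binary_value_monom_mult_unit_sum[of 1 c m] by (simp add: p_def c)
  moreover have one: "binary_value m 1 = 1 / 2"
    using binary_value_monom[of 0 m] by (simp add: c)
  moreover have "binary_value m (p \<circ>\<^sub>p [:1, 1:]) = 1 / 2 ^ m + 1 / 2" if "c \<noteq> 0"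
    unfolding p' using that one by (subst binary_value_add) (auto simp: binary_value_monom c)
  ultimately have diff: "sobol_point m p - sobol_point m 1 = (- (1 / 2 ^ m), 1 / 2 ^ m)" if "c \<noteq> 0"
    using that by (simp add: sobol_point_def pcompose_1)
  have "degree p < m"
    by (auto simp: p_def c coeff_monom_mult coeff_unit_sum intro!: degree_lessI)
  then show ?thesis
  proof (cases "c = 0")
    case False
    then show ?thesis
      using separation_radius_le[OF _ _ _ diff refl] \<open>degree p < m\<close> \<open>0 < m\<close> by simp
  next
    \<comment> \<open>For \<open>m = 1\<close> the two monomials of the image of \<open>p\<close>
      cancel; but 1 is also a power of two minus 1.\<close>
    case True
    then show ?thesis
      using separation_radius_le_power_minus_1[of 1 1] by (simp add: c)
  qed
qed

text \<open>The condition \<open>3 m + 6 \<le> 4 u\<close> says that the radius \<open>2\<^bsup>-u\<^esup>\<close> is at most \<open>2\<^bsup>-3 m / 4 - 3 / 2\<^esup>\<close>.\<close>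

lemma two_powers_or_special:
  assumes "2 \<le> m" "m \<noteq> 5"
  shows "(\<exists>l k. 2 ^ l + 2 ^ k \<le> m \<and> 3 * m + 6 \<le> 4 * 2 ^ l + 4 * 2 ^ k) \<or>
    (\<exists>s. m + 1 = 2 ^ s) \<or> (\<exists>s. m = (2 :: nat) ^ s)"
proof -
  obtain s where s: "2 ^ s \<le> m + 2" "m + 2 < 2 ^ Suc s"
    using ex_power_ivl1[of 2 "m + 2"] by auto
  have "\<not> s < 2"
  proof
    assume "s < 2"
    then have "s = 0 \<or> s = 1" by linarith
    then show False using s assms by auto
  qed
  then obtain t where t: "s = t + 2"
    using le_Suc_ex[of 2 s] by (auto simp: add.commute)
  \<comment> \<open>\<open>4 * z\<close> is the largest power of two up to \<open>m + 2\<close>; the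
    shift by 2 puts the equality case \<open>m = 4 * z - 2\<close> at the start of the
    range.\<close>
  define z :: nat where "z = 2 ^ t"
  have z: "2 * z = 2 ^ (t + 1)" "4 * z = 2 ^ (t + 2)"
    by (simp_all add: z_def)
  have m: "4 * z \<le> m + 2" "m + 2 < 8 * z"
    using s by (simp_all add: z_def t)
  consider "t = 0" | "t = 1" | "2 \<le> t"
    by linarith
  then show ?thesis
  proof cases
    case 1
    then have "m = 2 ^ 1 \<or> m + 1 = 2 ^ 2 \<or> m = 2 ^ 2"
      using m assms by (auto simp: z_def)
    then show ?thesis
      by blast
  next
    case 2
    then have "8 \<le> m + 2" "m + 2 < 16"
      using m by (simp_all add: z_def)
    then consider "m = 6" | "m = 7" | "m = 8" | "m = 9" | "m = 10 \<or> m = 11" | "m = 12 \<or> m = 13"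
      by linarith
    then have "m + 1 = 2 ^ 3 \<or> (2 ^ 1 + 2 ^ 2 \<le> m \<and> 3 * m + 6 \<le> 4 * 2 ^ 1 + 4 * 2 ^ 2) \<or> 
       (2 ^ 2 + 2 ^ 2 \<le> m \<and> 3 * m + 6 \<le> 4 * 2 ^ 2 + 4 * 2 ^ 2) \<or>
       (2 ^ 3 + 2 ^ 0 \<le> m \<and> 3 * m + 6 \<le> 4 * 2 ^ 3 + 4 * 2 ^ 0) \<or>
       (2 ^ 3 + 2 ^ 1 \<le> m \<and> 3 * m + 6 \<le> 4 * 2 ^ 3 + 4 * 2 ^ 1) \<or>
       (2 ^ 3 + 2 ^ 2 \<le> m \<and> 3 * m + 6 \<le> 4 * 2 ^ 3 + 4 * 2 ^ 2)"
      by cases auto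
    then show ?thesis
      by blast
  next
    case 3
    then have "4 \<le> z"
      using power_increasing[of 2 t "2 :: nat"] by (simp add: z_def)
    \<comment> \<open>The sums \<open>3 * z\<close>, \<open>4 * z\<close>, \<open>5 * z\<close>,
      \<open>6 * z\<close> of two powers serve (a), (c), (d), (e); in (b), \<open>m + 1\<close> is a
      power of two. In (d), \<open>5 * z <= m\<close> relies on \<open>4 <= z\<close>.\<close>
    consider (a) "m + 2 = 4 * z" | (b) "m + 2 = 4 * z + 1" | (c) "4 * z + 2 \<le> m + 2" "3 * m + 6 \<le> 16 * z"
      | (d) "16 * z < 3 * m + 6" "m + 2 < 6 * z + 2" | (e) "6 * z + 2 \<le> m + 2"
      using m(1) by linarith
    then show ?thesis
    proof cases
      case a
      then have "2 * z + z \<le> m"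
        using \<open>4 \<le> z\<close> by linarith
      moreover have "3 * m + 6 \<le> 4 * (2 * z) + 4 * z"
        using \<open>4 \<le> z\<close> a m(2) by linarith
      ultimately show ?thesis
        by (intro disjI1 exI[of _ "t + 1"] exI[of _ "t"]) (simp add: z_def)
    next
      case b
      then have "m + 1 = 2 ^ (t + 2)"
        unfolding z(2)[symmetric] by linarith
      then show ?thesis
        by blast
    next
      case c
      then have "2 * z + 2 * z \<le> m"
        using \<open>4 \<le> z\<close> by linarith
      moreover have "3 * m + 6 \<le> 4 * (2 * z) + 4 * (2 * z)"
        using \<open>4 \<le> z\<close> c m(2) by linarith
      ultimately show ?thesis
        by (intro disjI1 exI[of _ "t + 1"] exI[of _ "t + 1"]) (simp add: z_def)
    next
      case d
      then have "4 * z + z \<le> m"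
        using \<open>4 \<le> z\<close> by linarith
      moreover have "3 * m + 6 \<le> 4 * (4 * z) + 4 * z"
        using \<open>4 \<le> z\<close> d m(2) by linarith
      ultimately show ?thesis
        by (intro disjI1 exI[of _ "t + 2"] exI[of _ "t"]) (simp add: z_def)
    next
      case e
      then have "4 * z + 2 * z \<le> m"
        using \<open>4 \<le> z\<close> by linarith
      moreover have "3 * m + 6 \<le> 4 * (4 * z) + 4 * (2 * z)"
        using \<open>4 \<le> z\<close> e m(2) by linarith
      ultimately show ?thesis
        by (intro disjI1 exI[of _ "t + 2"] exI[of _ "t + 1"]) (simp add: z_def)
    qed
  qed
qed

section \<open>The lower bound\<close>

text \<open>After the leading 1, the worst tail consists of \<open>- 1\<close> only and leaves one
  unit in the last place.\<close>

lemma signed_digit_sum_ge: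
  fixes d :: "nat \<Rightarrow> real"
  assumes "\<And>i. i < a \<Longrightarrow> d i = 0" "d a = 1" "\<And>i. - 1 \<le> d i" "a < m"
  shows "1 / 2 ^ m \<le> (\<Sum>i<m. d i / 2 ^ (i + 1))"
  using assms(4)
proof (induction m)
  case (Suc m)
  show ?case
  proof (cases "a = m")
    case True
    then show ?thesis
      using assms(1,2) by simp
  next
    case False
    have "- (1 / 2 ^ (m + 1)) \<le> d m / 2 ^ (m + 1)"
      using divide_right_mono[OF assms(3), of "2 ^ (m + 1)" m] by simp
    moreover have "1 / 2 ^ m = (1 / 2 ^ (m + 1) + 1 / 2 ^ (m + 1) :: real)"
      by simp
    ultimately show ?thesis
      using Suc.IH Suc.prems False by simp
  qed
qed simp

text \<open>Against the worst tail, a nonnegative digit at \<open>k\<close> saves at least its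
  weight \<open>1 / 2 ^ (k + 1)\<close>.\<close>

lemma signed_digit_sum_ge_add:
  fixes d :: "nat \<Rightarrow> real"
  assumes d: "\<And>i. i < a \<Longrightarrow> d i = 0" "d a = 1" "\<And>i. - 1 \<le> d i" "a < k" "0 \<le> d k" and "k < m"
  shows "1 / 2 ^ m + 1 / 2 ^ (k + 1) \<le> (\<Sum>i<m. d i / 2 ^ (i + 1))"
  using \<open>k < m\<close>
proof (induction m)
  case (Suc m)
  show ?case
  proof (cases "k = m")
    case True
    have "1 / 2 ^ k = (1 / 2 ^ (k + 1) + 1 / 2 ^ (k + 1) :: real)"
      by simp
    moreover have "0 \<le> d k / 2 ^ (k + 1)"
      using d(5) by simp
    ultimately show ?thesis
      using signed_digit_sum_ge[of a d k, OF d(1-4)] True by simp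
  next
    case False
    have "- (1 / 2 ^ (m + 1)) \<le> d m / 2 ^ (m + 1)"
      using divide_right_mono[OF assms(3), of "2 ^ (m + 1)" m] by simp
    moreover have "1 / 2 ^ m = (1 / 2 ^ (m + 1) + 1 / 2 ^ (m + 1) :: real)"
      by simp
    ultimately show ?thesis
      using Suc.IH Suc.prems False by simp
  qed
qed simp

definition digit_diff :: "bit poly \<Rightarrow> bit poly \<Rightarrow> nat \<Rightarrow> real" where
  "digit_diff p q i = of_bool (coeff p i = 1) - of_bool (coeff q i = 1)"

lemma binary_value_diff:
  "binary_value m p - binary_value m q = (\<Sum>i<m. digit_diff p q i / 2 ^ (i + 1))"
  by (simp add: binary_value_def digit_diff_def diff_divide_distrib sum_subtractf)

lemma digit_diff_eq_0_iff: "digit_diff p q i = 0 \<longleftrightarrow> coeff p i = coeff q i"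
  by (cases "coeff p i"; cases "coeff q i") (auto simp: digit_diff_def)

lemma digit_diff_ge: "- 1 \<le> digit_diff p q i"
  by (simp add: digit_diff_def)

text \<open>Ordering the pair by its first differing digit makes the leading difference 1 and
  disposes of the absolute value.\<close>

lemma first_digit_diff:
  assumes "\<bar>binary_value m p - binary_value m q\<bar> < c" and "coeff p k \<noteq> coeff q k"
  obtains a p' q' where "{p', q'} = {p, q}" "a \<le> k"
    "\<And>i. i < a \<Longrightarrow> digit_diff p' q' i = 0" "digit_diff p' q' a = 1"
    "binary_value m p' - binary_value m q' < c"
proof -
  define a where "a = (LEAST i. coeff p i \<noteq> coeff q i)"
  have a: "coeff p a \<noteq> coeff q a" "a \<le> k" "\<And>i. i < a \<Longrightarrow> coeff p i = coeff q i"
    unfolding a_def using assms(2)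
    by (fact LeastI, fact Least_le) (auto dest: not_less_Least)
  show thesis
  proof (cases "coeff p a = 1")
    case True
    with a show ?thesis
      using that[of p q a] assms(1) by (auto simp: digit_diff_eq_0_iff) (auto simp: digit_diff_def)
  next
    case False
    with a show ?thesis
      using that[of q p a] insert_commute[of q p "{}"] assms(1)
      by (auto simp: digit_diff_eq_0_iff) (auto simp: digit_diff_def)
  qed
qed

text \<open>Cancellation below the leading difference forces the digits \<open>10\<dots>0\<close> against \<open>01\<dots>1\<close>.\<close>

lemma close_imp_carry:
  assumes "\<bar>binary_value m p - binary_value m q\<bar> < 1 / 2 ^ n" "n \<le> m"
  shows "\<exists>a\<le>n. \<forall>i<n. coeff (p + q) i = of_bool (a \<le> i)"
proof (cases "\<forall>i<n. coeff p i = coeff q i")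
  case True
  \<comment> \<open>Agreement counts as a carry starting past the last digit,
    \<open>a = n\<close>.\<close>
  then have "\<forall>i<n. coeff (p + q) i = of_bool (n \<le> i)"
    by simp
  then show ?thesis
    by blast
next
  case False
  then obtain k where k: "k < n" "coeff p k \<noteq> coeff q k"
    by blast
  obtain a p' q' where a: "{p', q'} = {p, q}" "a \<le> k"
      "\<And>i. i < a \<Longrightarrow> digit_diff p' q' i = 0" "digit_diff p' q' a = 1"
      "binary_value m p' - binary_value m q' < 1 / 2 ^ n"
    using first_digit_diff[OF assms(1) k(2)] by metis
  have "coeff (p' + q') i = of_bool (a \<le> i)" if "i < n" for i
  proof -
    consider "i < a" | "i = a" | "a < i"
      by linarith
    then show ?thesis
    proof cases
      case 1
      then show ?thesis
        using a(3) by (simp add: digit_diff_eq_0_iff)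
    next
      case 2
      then show ?thesis
        using a(4) by (auto simp: digit_diff_def of_bool_def split: if_splits)
    next
      case 3
      \<comment> \<open>A nonnegative digit after the leading one would push the difference above
        \<open>1 / 2 ^ (i + 1)\<close>, hence above \<open>1 / 2 ^ n\<close>.\<close>
      have "digit_diff p' q' i < 0"
      proof (rule ccontr)
        assume "\<not> digit_diff p' q' i < 0"
        then have "1 / 2 ^ m + 1 / 2 ^ (i + 1) \<le> binary_value m p' - binary_value m q'"
          unfolding binary_value_diff using a(3,4) digit_diff_ge 3 that assms(2)
          by (intro signed_digit_sum_ge_add) auto
        moreover have "1 / 2 ^ n \<le> (1 / 2 ^ (i + 1) :: real)"
          using that by (intro divide_left_mono power_increasing) auto
        moreover have "0 < (1 / 2 ^ m :: real)"
          by simp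
        ultimately show False
          using a(5) by linarith
      qed
      then show ?thesis
        using 3 by (auto simp: digit_diff_def of_bool_def split: if_splits)
    qed
  qed
  moreover have "p' + q' = p + q"
    using a(1) by (auto simp: doubleton_eq_iff add.commute)
  moreover have "a \<le> n"
    using a(2) k(1) by simp
  ultimately show ?thesis
    by auto
qed

text \<open>Equal digits from \<open>n\<close> on leave a sum of \<open>n\<close> signed digits,
  which is at least \<open>1 / 2 ^ n\<close> after orientation if any digit differs.\<close>

lemma close_imp_eq:
  assumes "\<bar>binary_value m p - binary_value m q\<bar> < 1 / 2 ^ n" "n \<le> m"
    and high: "\<And>i. n \<le> i \<Longrightarrow> coeff p i = coeff q i"
  shows "p = q"
proof (rule ccontr)
  assume "p \<noteq> q"
  then obtain k where k: "coeff p k \<noteq> coeff q k"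
    using poly_eqI by blast
  obtain a p' q' where a: "{p', q'} = {p, q}" "a \<le> k"
      "\<And>i. i < a \<Longrightarrow> digit_diff p' q' i = 0" "digit_diff p' q' a = 1"
      "binary_value m p' - binary_value m q' < 1 / 2 ^ n"
    using first_digit_diff[OF assms(1) k] by metis
  have "k < n"
    using high k by (meson not_le)
  have "digit_diff p' q' i = 0" if "n \<le> i" for i
    using high[OF that] a(1) by (auto simp: digit_diff_eq_0_iff doubleton_eq_iff)
  then have "binary_value m p' - binary_value m q' = (\<Sum>i<n. digit_diff p' q' i / 2 ^ (i + 1))"
    unfolding binary_value_diff using assms(2) by (intro sum.mono_neutral_right) auto
  moreover have "1 / 2 ^ n \<le> (\<Sum>i<n. digit_diff p' q' i / 2 ^ (i + 1))"
    using a(2-4) \<open>k < n\<close> digit_diff_ge by (intro signed_digit_sum_ge[of a]) auto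
  ultimately show False
    using a(5) by simp
qed

text \<open>Modulo \<open>X ^ n\<close>, \<open>e\<close> is
  \<open>X ^ a + ... + X ^ (n - 1)\<close>, and multiplication by \<open>1 + X\<close> telescopes.
  The degree of \<open>e\<close> bounds that of the quotient \<open>r\<close>.\<close>

lemma carry_poly:
  fixes e :: "bit poly"
  assumes "degree e + 1 < n + w" "a \<le> n" "0 < w" "\<And>i. i < n \<Longrightarrow> coeff e i = of_bool (a \<le> i)"
  obtains r where "degree r < w" "[:1, 1:] * e = monom 1 a + monom 1 n * r"
proof -
  define f where "f = [:1, 1:] * e + monom 1 a"
  have f: "coeff f i = coeff e i + (if i = 0 then 0 else coeff e (i - 1)) + of_bool (i = a)" for i
    unfolding f_def by (simp only: coeff_add coeff_one_plus_X_mult coeff_monom) auto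
  have "coeff f i = 0" if "i < n" for i
  proof (cases i)
    case 0
    then show ?thesis
      using that assms(4) by (simp add: f)
  next
    case (Suc j)
    then have "coeff f i = of_bool (a \<le> i) + of_bool (a \<le> j) + of_bool (i = a)"
      using that assms(4) by (simp add: f)
    also have "\<dots> = 0"
      using Suc by (cases "a \<le> j"; cases "a = i") auto
    finally show ?thesis .
  qed
  then obtain r where r: "f = monom 1 n * r"
    by (metis monom_1_dvd_iff' dvdE)
  have "coeff r i = 0" if "w \<le> i" for i
  proof -
    have "coeff r i = coeff f (n + i)"
      by (simp add: r coeff_monom_mult)
    also have "\<dots> = 0"
      using that assms by (simp add: f coeff_eq_0)
    finally show ?thesis .
  qed
  then have "degree r < w"
    using assms(3) by (intro degree_lessI) auto
  moreover have "[:1, 1:] * e = monom 1 a + monom 1 n * r"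
    by (simp only: r[symmetric] f_def add.left_commute[of "monom 1 a"] bit_poly_add_self add_0_right)
  ultimately show thesis
    by (rule that)
qed

lemma close_points_eq:
  assumes w: "w = 2 ^ v" and n: "n + 1 = 3 * w" and m: "m + 2 = 4 * w"
    and deg: "degree p < m" "degree q < m"
    and close: "\<bar>binary_value m p - binary_value m q\<bar> < 1 / 2 ^ n"
      "\<bar>binary_value m (p \<circ>\<^sub>p [:1, 1:]) - binary_value m (q \<circ>\<^sub>p [:1, 1:])\<bar> < 1 / 2 ^ n"
  shows "p = q"
proof -
  let ?X = "[:1, 1 :: bit:]"
  define e where "e = p + q"
  have "0 < w"
    by (simp add: w)
  then have "n \<le> m"
    using n m by linarith
  have "degree e < m"
    unfolding e_def using deg by (rule degree_add_less)
  then have deg_e: "degree e + 1 < n + w"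
    using n m by linarith
  have e': "e \<circ>\<^sub>p ?X = p \<circ>\<^sub>p ?X + q \<circ>\<^sub>p ?X"
    by (simp add: e_def pcompose_add)
  have deg_e': "degree (e \<circ>\<^sub>p ?X) + 1 < n + w"
    using deg_e by (simp add: degree_pcompose)
  obtain a where a: "a \<le> n" "\<And>i. i < n \<Longrightarrow> coeff e i = of_bool (a \<le> i)"
    using close_imp_carry[OF close(1) \<open>n \<le> m\<close>] unfolding e_def by blast
  obtain b where b: "b \<le> n" "\<And>i. i < n \<Longrightarrow> coeff (e \<circ>\<^sub>p ?X) i = of_bool (b \<le> i)"
    using close_imp_carry[OF close(2) \<open>n \<le> m\<close>] unfolding e' by blast
  obtain r where r: "degree r < w" "?X * e = monom 1 a + monom 1 n * r"
    using carry_poly[OF deg_e a(1) \<open>0 < w\<close> a(2)] .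
  obtain s where s: "degree s < w" "?X * (e \<circ>\<^sub>p ?X) = monom 1 b + monom 1 n * s"
    using carry_poly[OF deg_e' b(1) \<open>0 < w\<close> b(2)] .
  have X_eq: "[:0, 1 :: bit:] = monom 1 1"
    by (simp add: monom_altdef)
  \<comment> \<open>Since \<open>1 + (1 + X) = X\<close>, the condition on the second coordinate can
    be carried back to \<open>e\<close>, now modulo a power of \<open>1 + X\<close>.\<close>
  have invol: "(e \<circ>\<^sub>p ?X) \<circ>\<^sub>p ?X = e"
    by (metis one_plus_X_pcompose pcompose_assoc pcompose_idR X_eq)
  have "monom 1 1 * e = ?X ^ b + ?X ^ n * (s \<circ>\<^sub>p ?X)"
    using arg_cong[OF s(2), of "\<lambda>p. p \<circ>\<^sub>p ?X"]
    by (simp only: pcompose_mult pcompose_add pcompose_monom one_plus_X_pcompose invol) simp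
  \<comment> \<open>Multiplying each identity by the factor of the other yields two expressions for
    \<open>X (1 + X) e\<close>; the exponents rise to \<open>Suc n = 3 * w\<close>, and
    \<open>Suc a\<close> is positive.\<close>
  then have 1: "?X * (monom 1 1 * e) = ?X ^ Suc b + ?X ^ Suc n * (s \<circ>\<^sub>p ?X)"
    by (simp only: ring_distribs power_Suc mult.assoc)
  have 2: "monom 1 1 * (?X * e) = monom 1 (Suc a) + monom 1 (Suc n) * r"
    unfolding r(2) by (simp add: ring_distribs mult_monom mult.assoc[symmetric])
  have "r = 1"
  proof (rule block_equation[OF w])
    show "monom 1 (Suc a) + monom 1 (3 * w) * r = ?X ^ Suc b + ?X ^ (3 * w) * (s \<circ>\<^sub>p ?X)"
      using 1 2 n by (simp only: mult.left_commute Suc_eq_plus1)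
    show "degree (s \<circ>\<^sub>p ?X) < w"
      using s(1) by (simp add: degree_pcompose)
  qed (use a b r n in auto)
  \<comment> \<open>With \<open>r = 1\<close>, \<open>(1 + X) e = X ^ a + X ^ n\<close>, so
    \<open>e\<close> has no coefficient from degree \<open>n\<close> on.\<close>
  have "degree (?X * e) \<le> n"
    unfolding r(2) \<open>r = 1\<close> using a(1) by (auto intro!: degree_add_le simp: degree_monom_eq)
  have "0 < n"
    using n \<open>0 < w\<close> by linarith
  have "degree e < n"
  proof (cases "e = 0")
    case False
    then have "degree (?X * e) = 1 + degree e"
      by (subst degree_mult_eq) auto
    with \<open>degree (?X * e) \<le> n\<close> show ?thesis
      by linarith
  qed (use \<open>0 < n\<close> in simp)
  then have "coeff p i = coeff q i" if "n \<le> i" for i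
    using coeff_eq_0[of e i] that by (cases "coeff p i"; cases "coeff q i") (auto simp: e_def)
  then show ?thesis
    by (rule close_imp_eq[OF close(1) \<open>n \<le> m\<close>])
qed

lemma separation_radius_ge:
  assumes w: "w = 2 ^ v" and m: "m + 2 = 4 * w"
  shows "1 / 2 ^ (3 * w) \<le> separation_radius (sobol_set (2 ^ m))"
proof -
  let ?Q = "sobol_set (2 ^ m)"
  let ?D = "{infnorm (x - y) | x y. x \<in> ?Q \<and> y \<in> ?Q \<and> x \<noteq> y}"
  have "0 < w"
    by (simp add: w)
  then obtain n where n: "n + 1 = 3 * w"
    by (metis Suc_eq_plus1 gr0_conv_Suc mult_pos_pos zero_less_numeral)
  have "0 < m"
    using m \<open>0 < w\<close> by linarith
  have Q: "?Q = sobol_point m ` {p. degree p < m}"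
    using \<open>0 < m\<close> by (rule sobol_set_eq)
  have "finite ?D"
    by (intro finite_distances) (simp add: sobol_set_def)
  moreover have "?D \<noteq> {}"
  proof -
    have "sobol_point m 0 \<noteq> sobol_point m 1"
      using binary_value_monom[of 0 m] \<open>0 < m\<close> by (simp add: sobol_point_def binary_value_def)
    moreover have "sobol_point m 0 \<in> ?Q" "sobol_point m 1 \<in> ?Q"
      using \<open>0 < m\<close> unfolding Q by auto
    ultimately show ?thesis
      by blast
  qed
  ultimately have "Min ?D \<in> ?D"
    by (rule Min_in)
  then obtain p q where pq: "degree p < m" "degree q < m" "sobol_point m p \<noteq> sobol_point m q"
      "Min ?D = infnorm (sobol_point m p - sobol_point m q)"
    unfolding Q by blast
  \<comment> \<open>Here \<open>n = 3 * w - 1\<close>; halving the distance for the radius gives the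
    exponent \<open>3 * w\<close>.\<close>
  have "1 / 2 ^ n \<le> Min ?D"
  proof (rule ccontr)
    assume "\<not> 1 / 2 ^ n \<le> Min ?D"
    then have "\<bar>binary_value m p - binary_value m q\<bar> < 1 / 2 ^ n"
      "\<bar>binary_value m (p \<circ>\<^sub>p [:1, 1:]) - binary_value m (q \<circ>\<^sub>p [:1, 1:])\<bar> < 1 / 2 ^ n"
      unfolding pq(4) by (simp_all add: sobol_point_def infnorm_Pair)
    then have "p = q"
      using close_points_eq[OF w n m pq(1,2)] by blast
    with pq(3) show False
      by simp
  qed
  then show ?thesis
    unfolding separation_radius_def n[symmetric] by simp
qed

section \<open>Conversion to real exponents and assembly of the bounds\<close>

lemma le_two_powr:
  assumes "x \<le> 1 / 2 ^ u" "- real u \<le> y"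
  shows "x \<le> 2 powr y"
proof -
  have "1 / 2 ^ u = 2 powr (- real u)"
    by (simp add: powr_minus_divide powr_realpow)
  also have "\<dots> \<le> 2 powr y"
    using assms(2) by simp
  finally show ?thesis
    using assms(1) by linarith
qed

lemma separation_radius_upper_bound:
  assumes "2 \<le> m" "m \<noteq> 5"
  shows "separation_radius (sobol_set (2 ^ m)) \<le> 2 powr (- (3 * real m / 4) - 3 / 2)"
proof -
  consider l k where "2 ^ l + 2 ^ k \<le> m" "3 * m + 6 \<le> 4 * 2 ^ l + 4 * 2 ^ k"
    | s where "m + 1 = 2 ^ s" | s where "m = 2 ^ s"
    using two_powers_or_special[OF assms] by blast
  then show ?thesis
  proof cases
    case 1
    have "3 * real m + 6 \<le> 4 * 2 ^ l + 4 * 2 ^ k"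
      using of_nat_mono[OF 1(2), where 'a = real] by simp
    then show ?thesis
      by (intro le_two_powr[OF separation_radius_le_two_powers[OF 1(1)]]) simp
  next
    case 2
    \<comment> \<open>\<open>m + 1 >= 3 * m / 4 + 3 / 2\<close> amounts to \<open>m >= 2\<close>;
      likewise in the next case.\<close>
    show ?thesis
      using assms(1) by (intro le_two_powr[OF separation_radius_le_power_minus_1[OF 2]]) simp_all
  next
    case 3
    show ?thesis
      using assms(1) by (intro le_two_powr[OF separation_radius_le_power[OF 3]]) simp_all
  qed
qed

theorem corollary1p2:
  shows "(\<forall>m::nat. m \<ge> 1 \<longrightarrow>
            separation_radius (sobol_set (2 ^ m)) \<le> 2 powr (- (3 * real m / 4) - 5 / 4)) \<and>
         (\<forall>m::nat. m \<ge> 1 \<and> m \<noteq> 1 \<and> m \<noteq> 5 \<longrightarrow>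
            separation_radius (sobol_set (2 ^ m)) \<le> 2 powr (- (3 * real m / 4) - 3 / 2)) \<and>
         (\<forall>m v::nat. v \<ge> 2 \<and> m = 2 ^ v - 2 \<longrightarrow>
            separation_radius (sobol_set (2 ^ m)) = 2 powr (- (3 * real m / 4) - 3 / 2))"
proof (intro conjI allI impI)
  fix m :: nat
  assume "m \<ge> 1"
  then consider "m = 1" | "m = 5" | "2 \<le> m" "m \<noteq> 5"
    by linarith
  then show "separation_radius (sobol_set (2 ^ m)) \<le> 2 powr (- (3 * real m / 4) - 5 / 4)"
  proof cases
    \<comment> \<open>For \<open>m = 1\<close> and \<open>m = 5\<close> the exponent
      \<open>3 * m / 4 + 5 / 4\<close> is exactly 2 and 5, where
      \<open>5 = 2 ^ 2 + 2 ^ 0\<close>.\<close>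
    case 1
    then show ?thesis
      by (intro le_two_powr[OF separation_radius_le_power_minus_1[of m 1]]) simp_all
  next
    case 2
    then show ?thesis
      by (intro le_two_powr[OF separation_radius_le_two_powers[of 2 0 m]]) simp_all
  next
    case 3
    have "2 powr (- (3 * real m / 4) - 3 / 2) \<le> 2 powr (- (3 * real m / 4) - 5 / 4)"
      by simp
    with separation_radius_upper_bound[OF 3] show ?thesis
      by linarith
  qed
next
  fix m :: nat
  assume "m \<ge> 1 \<and> m \<noteq> 1 \<and> m \<noteq> 5"
  then show "separation_radius (sobol_set (2 ^ m)) \<le> 2 powr (- (3 * real m / 4) - 3 / 2)"
    by (intro separation_radius_upper_bound) auto
next
  fix m v :: nat
  assume v: "v \<ge> 2 \<and> m = 2 ^ v - 2"
  define w :: nat where "w = 2 ^ (v - 2)"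
  have "1 \<le> w"
    by (simp add: w_def)
  have "2 ^ v = 4 * w"
    using v by (auto simp: w_def power_add dest!: le_Suc_ex)
  then have m: "m + 2 = 4 * w"
    using v \<open>1 \<le> w\<close> by linarith
  \<comment> \<open>The exponent is \<open>3 * (m + 2) / 4 = 3 * w\<close> up to sign.\<close>
  have "2 powr (- (3 * real m / 4) - 3 / 2) = 2 powr (- real (3 * w))"
    using arg_cong[OF m, of real] by (intro arg_cong[of _ _ "\<lambda>x. 2 powr x"]) simp
  also have "\<dots> = 1 / 2 ^ (3 * w)"
    by (simp only: powr_minus_divide powr_realpow zero_less_numeral)
  also have "\<dots> \<le> separation_radius (sobol_set (2 ^ m))"
    by (rule separation_radius_ge[OF w_def m])
  finally have "2 powr (- (3 * real m / 4) - 3 / 2) \<le> separation_radius (sobol_set (2 ^ m))" .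
  moreover have "2 \<le> m" "m \<noteq> 5"
    using m \<open>1 \<le> w\<close> by presburger+
  ultimately show "separation_radius (sobol_set (2 ^ m)) = 2 powr (- (3 * real m / 4) - 3 / 2)"
    using separation_radius_upper_bound by (intro antisym) auto
qed

end
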